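(* Let $f=h+\overline{g}\in\mathcal{H}$, with $h(z)=z+\sum_{n=2}^\infty a_nz^n$ and $g(z)=\sum_{n=1}^\infty b_nz^n$, satisfy $$\sum_{n=2}^\infty n|a_n|+\sum_{n=1}^\infty n|b_n|\le\frac12.$$ Let $a>-1$ and $b>-1$ be real numbers, and set $H=H_{a,b}(h)$ and $G=H_{a,b}(g)$, so that $$H(z)=z+\sum_{n=2}^\infty\frac{(a+1)(b+1)}{(a+n)(b+n)}a_nz^n,\qquad G(z)=\sum_{n=1}^\infty\frac{(a+1)(b+1)}{(a+n)(b+n)}b_nz^n.$$ Then the harmonic function $F=H+\overline{G}$ belongs to $\mathcal{UK}_H$, provided $a,b$ satisfy one of the following conditions: (i) $ab\le3$; (ii) $ab>3$ and $a^2b^2-4ab-2(a+b)\le1$.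
   Context: $\mathbb{D}=\{z\in\mathbb{C}:|z|<1\}$. $\mathcal{H}$ is the class of complex-valued harmonic functions $f=h+\overline{g}$ in $\mathbb{D}$, with $h,g$ analytic in $\mathbb{D}$ and $h(z)=z+\sum_{n\ge2}a_nz^n$, $g(z)=\sum_{n\ge1}b_nz^n$. $\mathcal{S}_H$ is the class of $f\in\mathcal{H}$ that are univalent and sense-preserving ($J_f=|h'|^2-|g'|^2>0$) in $\mathbb{D}$. For real $a,b>-1$, $a\neq b$, and $h$ analytic in $\mathbb{D}$ with $h(z)=\sum_{n\ge1}a_nz^n$, $$H_{a,b}(h)(z)=\frac{(a+1)(b+1)}{b-a}\int_0^1t^{a-1}(1-t^{b-a})h(tz)\,dt=\sum_{n=1}^\infty\frac{(a+1)(b+1)}{(a+n)(b+n)}a_nz^n;$$ for $a=b$ it is understood as the limit $b\to a$, $H_{a,a}(h)(z)=-(a+1)^2\int_0^1t^{a-1}(\log t)h(tz)\,dt=\sum_{n\ge1}\frac{(a+1)^2}{(a+n)^2}a_nz^n$. A locally univalent $f\in\mathcal{H}$ is fully convex if $f(\{|z|<r\})$ is a convex domain for each $r\in(0,1)$. It is uniformly convex in $\mathbb{D}$ if it is fully convex in $\mathbb{D}$ and maps every circular arc $\gamma$ contained in $\mathbb{D}$ with center in $\mathbb{D}$ onto a convex arc $f(\gamma)$ (the tangent direction turns monotonically, in the positive sense, as $\gamma$ is traversed positively). It is known that uniform convexity is equivalent to $\operatorname{Re}P(z,\zeta)\ge0$ for all $z\ne\zeta$ in $\mathbb{D}$, where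 $$P(z,\zeta)=\frac{(z-\zeta)h'(z)+(z-\zeta)^2h''(z)+\overline{(z-\zeta)g'(z)}+\overline{(z-\zeta)^2g''(z)}}{(z-\zeta)h'(z)-\overline{(z-\zeta)g'(z)}}.$$ $\mathcal{UK}_H$ is the class of all $f\in\mathcal{S}_H$ that are uniformly convex in $\mathbb{D}$. *)

theory Defs
  imports "HOL-Complex_Analysis.Complex_Analysis" "HOL-Real_Asymp.Real_Asymp"
begin

abbreviation unit_disc :: "complex set" ("\<D>") where
  "\<D> \<equiv> ball 0 1"

definition canonical_decomp ::
    "(complex \<Rightarrow> complex) \<Rightarrow> (complex \<Rightarrow> complex) \<Rightarrow> (complex \<Rightarrow> complex) \<Rightarrow> bool" where
  "canonical_decomp f h g \<longleftrightarrow>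
     h holomorphic_on \<D> \<and> g holomorphic_on \<D> \<and>
     h 0 = 0 \<and> deriv h 0 = 1 \<and> g 0 = 0 \<and>
     (\<forall>z\<in>\<D>. f z = h z + cnj (g z))"

definition harmonic_class :: "(complex \<Rightarrow> complex) set" where
  "harmonic_class = {f. \<exists>h g. canonical_decomp f h g}"

(* The normalisation g 0 = 0 makes h and g unique on the disc, so the choice of
   witnesses does not affect the Jacobian. *)
definition S_H :: "(complex \<Rightarrow> complex) set" where
  "S_H = {f. inj_on f \<D> \<and>
     (\<exists>h g. canonical_decomp f h g \<and>
        (\<forall>z\<in>\<D>. (norm (deriv h z))\<^sup>2 - (norm (deriv g z))\<^sup>2 > 0))}"

definition locally_univalent :: "(complex \<Rightarrow> complex) \<Rightarrow> bool" where
  "locally_univalent f \<longleftrightarrow> (\<forall>z\<in>\<D>. \<exists>e>0. inj_on f (ball z e \<inter> \<D>))"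

definition fully_convex :: "(complex \<Rightarrow> complex) \<Rightarrow> bool" where
  "fully_convex f \<longleftrightarrow> f \<in> harmonic_class \<and> locally_univalent f \<and>
     (\<forall>r\<in>{0<..<1}. open (f ` ball 0 r) \<and> convex (f ` ball 0 r))"

(* The function \<theta> is a continuous branch of the argument of the (nonvanishing) tangent
   vector; the arc is convex if this tangent direction never turns clockwise. *)
definition convex_arc :: "(real \<Rightarrow> complex) \<Rightarrow> real \<Rightarrow> real \<Rightarrow> bool" where
  "convex_arc \<gamma> \<alpha> \<beta> \<longleftrightarrow>
     (\<exists>\<theta>. continuous_on {\<alpha>..\<beta>} \<theta> \<and> mono_on {\<alpha>..\<beta>} \<theta> \<and>
        (\<forall>t\<in>{\<alpha>..\<beta>}. \<exists>s>0.
           (\<gamma> has_vector_derivative s *\<^sub>R cis (\<theta> t)) (at t within {\<alpha>..\<beta>})))"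

(* Only the arc and its centre c have to lie in the disc, not the whole circle;
   full circles are included (\<beta> = \<alpha> + 2 * pi). *)
definition uniformly_convex :: "(complex \<Rightarrow> complex) \<Rightarrow> bool" where
  "uniformly_convex f \<longleftrightarrow> fully_convex f \<and>
     (\<forall>c\<in>\<D>. \<forall>\<rho>>0. \<forall>\<alpha> \<beta>. \<alpha> < \<beta> \<longrightarrow> \<beta> \<le> \<alpha> + 2 * pi \<longrightarrow>
        (\<forall>t\<in>{\<alpha>..\<beta>}. c + of_real \<rho> * cis t \<in> \<D>) \<longrightarrow>
        convex_arc (\<lambda>t. f (c + of_real \<rho> * cis t)) \<alpha> \<beta>)"

definition UK_H :: "(complex \<Rightarrow> complex) set" where
  "UK_H = {f \<in> S_H. uniformly_convex f}"

(* The branch a = b is the limit of the other one as b tends to a; H_op_series below gives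
   the uniform description of both on the disc by the coefficient multipliers
   (a + 1) * (b + 1) / ((a + n) * (b + n)). *)
definition H_op :: "real \<Rightarrow> real \<Rightarrow> (complex \<Rightarrow> complex) \<Rightarrow> complex \<Rightarrow> complex" where
  "H_op a b h z =
     (if a = b then
        - of_real ((a + 1)\<^sup>2) *
          integral {0..1} (\<lambda>t. of_real (t powr (a - 1) * ln t) * h (of_real t * z))
      else
        of_real ((a + 1) * (b + 1) / (b - a)) *
          integral {0..1} (\<lambda>t. of_real (t powr (a - 1) * (1 - t powr (b - a))) * h (of_real t * z)))"


lemma moment_series:
  fixes K :: "real \<Rightarrow> real" and A :: "nat \<Rightarrow> complex"
  assumes K: "\<And>n. n \<ge> 1 \<Longrightarrow> ((\<lambda>t. K t * t ^ n) has_integral m n) {0..1}"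
    and K0: "\<And>t. t \<in> {0..1} \<Longrightarrow> K t \<ge> 0"
    and hs: "\<And>z. z \<in> \<D> \<Longrightarrow> ((\<lambda>n. A n * z ^ n) has_sum h z) {1..}"
    and z: "z \<in> \<D>"
  shows "((\<lambda>n. of_real (m n) * A n * z ^ n) has_sum
           integral {0..1} (\<lambda>t. of_real (K t) * h (of_real t * z))) {1..}"
proof -
  have img: "Suc ` UNIV = {1..}"
    by (auto simp: image_iff) (metis Suc_le_D)
  have re: "(F has_sum x) {1..} \<longleftrightarrow> ((\<lambda>n. F (Suc n)) has_sum x) UNIV"
    for F :: "nat \<Rightarrow> complex" and x
    unfolding img[symmetric] by (subst has_sum_reindex) (auto simp: o_def)
  define c where "c n = A (Suc n) * z ^ Suc n" for n
  have cs: "(c has_sum h z) UNIV"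
    using hs[OF z] unfolding re c_def .
  then have abs_c: "summable (\<lambda>n. norm (c n))"
    by (metis has_sum_imp_summable summable_on_iff_abs_summable_on_complex
        summable_on_imp_summable)
  define M where "M = (\<Sum>n. norm (c n))"
  define f where "f k t = (\<Sum>n<k. of_real (K t * t ^ Suc n) * c n)" for k t
  have term_int: "((\<lambda>t. of_real (K t * t ^ Suc n) * c n) has_integral of_real (m (Suc n)) * c n) {0..1}" for n
    using has_integral_mult_left[OF has_integral_of_real[OF K[of "Suc n"]], of "c n"] by simp
  have f_int: "(f k has_integral (\<Sum>n<k. of_real (m (Suc n)) * c n)) {0..1}" for k
    unfolding f_def by (intro has_integral_sum term_int) auto
  have dom_int: "(\<lambda>t. M * (K t * t ^ 1)) integrable_on {0..1}"
    using K[of 1] by (intro integrable_on_mult_right) (auto simp: integrable_on_def)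
  have bound: "norm (f k t) \<le> M * (K t * t ^ 1)" if t: "t \<in> {0..1}" for k t
  proof -
    have "norm (f k t) \<le> (\<Sum>n<k. norm (of_real (K t * t ^ Suc n) * c n))"
      unfolding f_def by (rule norm_sum)
    also have "\<dots> \<le> (\<Sum>n<k. (K t * t) * norm (c n))"
    proof (rule sum_mono)
      fix n
      have "norm (of_real (K t * t ^ Suc n) * c n) = (K t * t) * (t ^ n * norm (c n))"
        using t K0[OF t] by (simp add: norm_mult norm_power abs_mult)
      also have "\<dots> \<le> (K t * t) * (1 * norm (c n))"
        using t K0[OF t] by (intro mult_left_mono mult_right_mono) (auto simp: power_le_one)
      finally show "norm (of_real (K t * t ^ Suc n) * c n) \<le> (K t * t) * norm (c n)" by simp
    qed
    also have "\<dots> = (K t * t) * (\<Sum>n<k. norm (c n))"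
      by (simp add: sum_distrib_left)
    also have "\<dots> \<le> (K t * t) * M"
      unfolding M_def using t K0[OF t] abs_c by (intro mult_left_mono sum_le_suminf) auto
    finally show ?thesis by (simp add: mult_ac)
  qed
  have lim: "(\<lambda>k. f k t) \<longlonglongrightarrow> of_real (K t) * h (of_real t * z)" if t: "t \<in> {0..1}" for t
  proof -
    have "norm (of_real t * z) \<le> 1 * norm z"
      unfolding norm_mult using t by (intro mult_right_mono) auto
    then have "of_real t * z \<in> \<D>" using z by simp
    from hs[OF this] have "(\<lambda>n. A (Suc n) * (of_real t * z) ^ Suc n) sums h (of_real t * z)"
      unfolding re by (rule has_sum_imp_sums)
    then have "(\<lambda>n. of_real (K t) * (A (Suc n) * (of_real t * z) ^ Suc n)) sums
                 (of_real (K t) * h (of_real t * z))"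
      by (rule sums_mult)
    then show ?thesis
      by (simp add: sums_def f_def c_def power_mult_distrib mult_ac)
  qed
  have "(\<lambda>k. integral {0..1} (f k)) \<longlonglongrightarrow> integral {0..1} (\<lambda>t. of_real (K t) * h (of_real t * z))"
    using f_int by (intro dominated_convergence(2)[OF _ dom_int bound lim]) (auto simp: integrable_on_def)
  then have S: "(\<lambda>n. of_real (m (Suc n)) * c n) sums integral {0..1} (\<lambda>t. of_real (K t) * h (of_real t * z))"
    using integral_unique[OF f_int] by (simp add: sums_def)
  have m_bd: "\<bar>m (Suc n)\<bar> \<le> m 1" for n
  proof -
    have "0 \<le> m (Suc n)"
      by (rule has_integral_nonneg[OF K]) (use K0 in auto)
    moreover have "m (Suc n) \<le> m 1"
    proof (rule has_integral_le[OF K K])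
      fix t :: real assume t: "t \<in> {0..1}"
      have "t * t ^ n \<le> t * 1" using t by (intro mult_left_mono power_le_one) auto
      then show "K t * t ^ Suc n \<le> K t * t ^ 1"
        using K0[OF t] by (intro mult_left_mono) auto
    qed auto
    ultimately show ?thesis by simp
  qed
  have "summable (\<lambda>n. norm (of_real (m (Suc n)) * c n))"
    by (rule summable_comparison_test'[OF summable_mult[OF abs_c, of "m 1"]])
      (auto simp: norm_mult intro!: mult_right_mono m_bd[unfolded One_nat_def])
  then show ?thesis
    unfolding re using norm_summable_imp_has_sum[OF _ S] by (simp add: c_def mult_ac)
qed

lemma has_integral_powr_01:
  assumes "p > (-1::real)"
  shows "((\<lambda>t. t powr p) has_integral 1 / (p + 1)) {0..1}"
  using has_integral_powr_from_0[OF assms, of 1] by simp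

lemma has_integral_powr_ln_01:
  assumes p: "p > (-1::real)"
  shows "((\<lambda>t. t powr p * ln t) has_integral - 1 / (p + 1)\<^sup>2) {0..1}"
proof -
  define F where "F t = t powr (p + 1) * ln t / (p + 1) - t powr (p + 1) / (p + 1)\<^sup>2" for t :: real
  have p1: "p + 1 > 0" using p by simp
  have "((\<lambda>t. t powr p * ln t) has_integral F 1 - F 0) {0..1}"
  proof (rule fundamental_theorem_of_calculus_interior)
    show "continuous_on {0..1} F"
    proof (rule continuous_on_eq_continuous_within[THEN iffD2], intro ballI)
      fix x :: real assume x: "x \<in> {0..1}"
      show "continuous (at x within {0..1}) F"
      proof (cases "x = 0")
        case True
        have "(F \<longlongrightarrow> 0) (at_right 0)"
          unfolding F_def using p1 by real_asymp
        then have "(F \<longlongrightarrow> F 0) (at_right 0)" by (simp add: F_def)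
        then have "(F \<longlongrightarrow> F 0) (at 0 within {0..1})"
          by (simp add: at_within_Icc_at_right)
        then show ?thesis using True by (simp add: continuous_within)
      next
        case False
        then have "isCont F x"
          using x unfolding F_def by (intro continuous_intros) (use p1 in auto)
        then show ?thesis by (rule continuous_at_imp_continuous_at_within)
      qed
    qed
  next
    fix x :: real assume x: "x \<in> {0<..<1}"
    have P: "((\<lambda>t. t powr (p + 1)) has_real_derivative (p + 1) * x powr p) (at x)"
      using has_real_derivative_powr[of x "p + 1"] x by simp
    have "(F has_real_derivative
            ((p + 1) * x powr p * ln x + 1 / x * x powr (p + 1)) / (p + 1) -
            (p + 1) * x powr p / (p + 1)\<^sup>2) (at x)"
      unfolding F_def using x
      by (intro DERIV_diff DERIV_cdivide DERIV_mult P DERIV_ln_divide) auto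
    also have "((p + 1) * x powr p * ln x + 1 / x * x powr (p + 1)) / (p + 1) -
            (p + 1) * x powr p / (p + 1)\<^sup>2 = x powr p * ln x"
      using x p1 by (simp add: powr_add add_divide_distrib power2_eq_square)
    finally have "(F has_real_derivative x powr p * ln x) (at x)" .
    then show "(F has_vector_derivative x powr p * ln x) (at x)"
      by (simp add: has_real_derivative_iff_has_vector_derivative)
  qed auto
  then show ?thesis by (simp add: F_def)
qed

lemma H_op_series:
  fixes A :: "nat \<Rightarrow> complex"
  assumes a: "a > -1" and b: "b > -1"
    and hs: "\<And>z. z \<in> \<D> \<Longrightarrow> ((\<lambda>n. A n * z ^ n) has_sum h z) {1..}"
    and z: "z \<in> \<D>"
  shows "((\<lambda>n. of_real ((a + 1) * (b + 1) / ((a + n) * (b + n))) * A n * z ^ n) has_sum H_op a b h z) {1..}"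
proof -
  have pw: "t powr (p - 1) * t ^ n = t powr (p - 1 + n)" if "t \<in> {0..1}" "n \<ge> 1" for t p :: real and n :: nat
    using that by (cases "t = 0") (auto simp: powr_add powr_realpow)
  show ?thesis
  proof (cases "a = b")
    case True
    define K where "K t = - (t powr (a - 1) * ln t)" for t :: real
    have K: "((\<lambda>t. K t * t ^ n) has_integral 1 / (a + n)\<^sup>2) {0..1}" if n: "n \<ge> 1" for n :: nat
    proof -
      have "((\<lambda>t. - (t powr (a - 1 + n) * ln t)) has_integral - (- 1 / (a - 1 + n + 1)\<^sup>2)) {0..1}"
        using a n by (intro has_integral_neg has_integral_powr_ln_01) auto
      then show ?thesis
        by (rule has_integral_eq_rhs[OF has_integral_eq, rotated])
          (use pw[OF _ n, of _ a] in \<open>auto simp: K_def mult_ac\<close>)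
    qed
    have K0: "K t \<ge> 0" if "t \<in> {0..1}" for t
      using that unfolding K_def by (cases "t = 0") (auto simp: mult_nonneg_nonpos)
    from has_sum_cmult_right[OF moment_series[OF K K0 hs z], of "of_real ((a + 1)\<^sup>2)"]
    show ?thesis
      using True by (simp add: H_op_def K_def power2_eq_square mult_ac)
  next
    case False
    define K where "K t = (t powr (a - 1) - t powr (b - 1)) / (b - a)" for t :: real
    have K: "((\<lambda>t. K t * t ^ n) has_integral 1 / ((a + n) * (b + n))) {0..1}" if n: "n \<ge> 1" for n :: nat
    proof -
      have "((\<lambda>t. (t powr (a - 1 + n) - t powr (b - 1 + n)) / (b - a)) has_integral
              (1 / (a - 1 + n + 1) - 1 / (b - 1 + n + 1)) / (b - a)) {0..1}"
        using a b n by (intro has_integral_divide has_integral_diff has_integral_powr_01) auto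
      moreover have "(1 / (a - 1 + n + 1) - 1 / (b - 1 + n + 1)) / (b - a) = 1 / ((a + n) * (b + n))"
      proof -
        have "a + n \<noteq> 0" "b + n \<noteq> 0" using a b n by auto
        then show ?thesis using False by (simp add: divide_simps)
      qed
      ultimately show ?thesis
        by (auto elim!: has_integral_eq[rotated]
            simp: K_def pw[OF _ n, symmetric] left_diff_distrib)
    qed
    have K0: "K t \<ge> 0" if t: "t \<in> {0..1}" for t
    proof (cases "a < b")
      case True
      then have "t powr (b - 1) \<le> t powr (a - 1)" using t by (intro powr_mono') auto
      then show ?thesis using True by (simp add: K_def)
    next
      case F: False
      then have "t powr (a - 1) \<le> t powr (b - 1)" using t by (intro powr_mono') auto
      then show ?thesis using F False by (simp add: K_def divide_nonpos_nonpos)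
    qed
    have eq: "integral {0..1} (\<lambda>t. of_real (t powr (a - 1) * (1 - t powr (b - a))) * h (of_real t * z))
      = of_real (b - a) * integral {0..1} (\<lambda>t. of_real (K t) * h (of_real t * z))"
    proof -
      have "t powr (a - 1) * (1 - t powr (b - a)) = (b - a) * K t" for t
      proof -
        have "t powr (a - 1) * (1 - t powr (b - a)) = t powr (a - 1) - t powr (b - 1)"
          by (simp add: right_diff_distrib flip: powr_add)
        then show ?thesis using False by (simp add: K_def)
      qed
      then have "(\<lambda>t. of_real (t powr (a - 1) * (1 - t powr (b - a))) * h (of_real t * z))
          = (\<lambda>t. of_real (b - a) * (of_real (K t) * h (of_real t * z)))"
        by (simp only: of_real_mult mult.assoc)
      then show ?thesis by (simp only: integral_mult_right)
    qed
    have "of_real ((a + 1) * (b + 1) / (b - a)) * (of_real (b - a) * I) = of_real ((a + 1) * (b + 1)) * I" for I :: complex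
    proof -
      have "complex_of_real ((a + 1) * (b + 1) / (b - a)) * of_real (b - a) = of_real ((a + 1) * (b + 1))"
        using False by (simp flip: of_real_mult)
      then show ?thesis by (metis mult.assoc)
    qed
    then have H: "H_op a b h z = of_real ((a + 1) * (b + 1)) * integral {0..1} (\<lambda>t. of_real (K t) * h (of_real t * z))"
      using False by (simp only: H_op_def if_False eq)
    have "of_real ((a + 1) * (b + 1)) * (of_real (1 / ((a + real n) * (b + real n))) * A n * z ^ n)
        = of_real ((a + 1) * (b + 1) / ((a + n) * (b + n))) * A n * z ^ n" for n
      by (simp add: mult_ac)
    then show ?thesis
      unfolding H using has_sum_cmult_right[OF moment_series[OF K K0 hs z], of "of_real ((a + 1) * (b + 1))"]
      by (simp only: )
  qed
qed

end

theory Submission imports Defs begin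

text \<open>The hypothesis makes \<open>F = H + cnj G\<close> a small perturbation of the identity, with a gain on
  second derivatives from the integral operator. Write \<open>c\<^sub>n = (a+1)(b+1)/((a+n)(b+n))\<close>. The two
  alternatives for \<open>a\<close> and \<open>b\<close> guarantee \<open>(2n-1) c\<^sub>n \<le> 2\<close> (lemma \<open>integral_multiplier_le\<close>), so the
  coefficients \<open>p\<^sub>n\<close> of \<open>H - id\<close> and \<open>q\<^sub>n\<close> of \<open>G\<close> satisfy \<open>\<Sum>n(2n-1)(|p\<^sub>n| + |q\<^sub>n|) \<le> 1\<close>, and
  \<open>c\<^sub>n \<le> 1\<close> gives \<open>\<Sum>n(|p\<^sub>n| + |q\<^sub>n|) \<le> 1/2\<close>. On the disc these sums bound the derivatives: there are
  constants with \<open>|H' - 1| + |G'| \<le> k < 1\<close>, \<open>|H''| + |G''| \<le> l\<close> and \<open>k + 2l \<le> 1\<close>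
  (lemma \<open>UK_H_if_coefficient_sum\<close>). These bounds imply everything else
  (lemma \<open>UK_H_if_derivative_bounds\<close>).

  Univalence and positivity of the Jacobian: \<open>F - id\<close> is a contraction with constant \<open>k\<close>.

  Convexity of the image of a disc \<open>|z| < r\<close>: a disc is strongly convex, so a convex combination
  of two of its points is surrounded by a disc whose radius is quadratic in their distance. The
  image of that small disc is at least \<open>1 - k\<close> times as large, and this compensates the
  curvature of \<open>F\<close>, a Taylor remainder controlled by \<open>l\<close>
  (lemma \<open>convex_image_lipschitz_perturbation_ball\<close>).

  Convexity of images of arcs: along \<open>z = c + w\<close>, \<open>w = \<rho> e\<^sup>i\<^sup>t\<close>, the tangent of the image is
  \<open>\<rho> i e\<^sup>i\<^sup>t B\<close> with \<open>B = H' - e\<^sup>-\<^sup>2\<^sup>i\<^sup>t cnj G'\<close>, which has positive real part. If \<open>B' = i M\<close>, the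
  tangent angle has derivative \<open>1 + Re (M/B)\<close>, and this is nonnegative if \<open>|M| \<le> |2B + M|\<close>.
  Since \<open>c\<close> and \<open>z\<close> both lie in the disc, \<open>|w| < 2\<close>, and then \<open>|M| \<le> 2|G'| + 2l\<close> whereas
  \<open>|2B + M| \<ge> 2|H'| - 2l\<close>; so \<open>k + 2l \<le> 1\<close> suffices
  (lemma \<open>convex_arc_if_tangent_turns_forward\<close>).\<close>

section \<open>Convex images of balls\<close>

text \<open>A quantitative open mapping property: the equation \<open>z + \<phi> z = w\<close> is the fixed point
  equation of the contraction \<open>z \<mapsto> w - \<phi> z\<close>, and the loss factor \<open>1 - k\<close> is exactly what keeps
  this contraction inside the ball.\<close>

lemma lipschitz_perturbation_covers_cball:
  fixes \<phi> :: "'a::banach \<Rightarrow> 'a"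
  assumes k: "0 \<le> k" "k < 1" and \<rho>: "0 \<le> \<rho>"
    and lip: "\<And>x y. x \<in> cball m \<rho> \<Longrightarrow> y \<in> cball m \<rho> \<Longrightarrow> norm (\<phi> x - \<phi> y) \<le> k * norm (x - y)"
    and w: "norm (w - (m + \<phi> m)) \<le> (1 - k) * \<rho>"
  shows "\<exists>z\<in>cball m \<rho>. z + \<phi> z = w"
proof -
  define T where "T z = w - \<phi> z" for z
  have "\<exists>!z. z \<in> cball m \<rho> \<and> T z = z"
  proof (rule Banach_fix[OF _ _ k])
    show "complete (cball m \<rho>)" by (simp add: complete_eq_closed)
    show "cball m \<rho> \<noteq> {}" using \<rho> by simp
    show "T ` cball m \<rho> \<subseteq> cball m \<rho>"
    proof clarify
      fix z assume z: "z \<in> cball m \<rho>"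
      have "norm (T z - m) = norm ((w - (m + \<phi> m)) - (\<phi> z - \<phi> m))"
        by (simp add: T_def algebra_simps)
      also have "\<dots> \<le> (1 - k) * \<rho> + k * norm (z - m)"
        using norm_triangle_ineq4[of "w - (m + \<phi> m)" "\<phi> z - \<phi> m"] w lip[OF z, of m] \<rho> by simp
      also have "\<dots> \<le> (1 - k) * \<rho> + k * \<rho>"
        using z k by (intro add_left_mono mult_left_mono) (auto simp: dist_norm norm_minus_commute)
      finally show "T z \<in> cball m \<rho>"
        by (simp add: dist_norm norm_minus_commute algebra_simps)
    qed
    show "dist (T x) (T y) \<le> k * dist x y" if "x \<in> cball m \<rho>" "y \<in> cball m \<rho>" for x y
      using lip[of y x] that by (simp add: T_def dist_norm norm_minus_commute)
  qed
  then obtain z where "z \<in> cball m \<rho>" "T z = z" by blast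
  then show ?thesis by (auto simp: T_def intro!: bexI[of _ z]) (metis diff_add_cancel)
qed

lemma open_image_lipschitz_perturbation:
  fixes \<phi> :: "'a::banach \<Rightarrow> 'a"
  assumes k: "0 \<le> k" "k < 1" and S: "open S"
    and lip: "\<And>x y. x \<in> S \<Longrightarrow> y \<in> S \<Longrightarrow> norm (\<phi> x - \<phi> y) \<le> k * norm (x - y)"
  shows "open ((\<lambda>z. z + \<phi> z) ` S)"
  unfolding open_contains_cball
proof clarify
  fix m assume "m \<in> S"
  then obtain \<rho> where \<rho>: "\<rho> > 0" "cball m \<rho> \<subseteq> S"
    using S by (meson open_contains_cball)
  have "cball (m + \<phi> m) ((1 - k) * \<rho>) \<subseteq> (\<lambda>z. z + \<phi> z) ` S"
  proof
    fix w assume "w \<in> cball (m + \<phi> m) ((1 - k) * \<rho>)"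
    then have "norm (w - (m + \<phi> m)) \<le> (1 - k) * \<rho>"
      by (simp add: dist_norm norm_minus_commute)
    then have "\<exists>z\<in>cball m \<rho>. z + \<phi> z = w"
      using \<rho> by (intro lipschitz_perturbation_covers_cball[OF k] lip) auto
    then show "w \<in> (\<lambda>z. z + \<phi> z) ` S" using \<rho> by blast
  qed
  then show "\<exists>e>0. cball (m + \<phi> m) e \<subseteq> (\<lambda>z. z + \<phi> z) ` S"
    using \<rho>(1) k by (intro exI[of _ "(1 - k) * \<rho>"]) auto
qed

text \<open>Polyak's principle: a smooth map with small second derivative preserves the convexity of a
  ball, because the ball is strongly convex. Around the convex combination \<open>m\<close> of two points of
  the ball there is room for a ball whose radius \<open>\<rho>\<close> is quadratic in their distance; the image of
  that small ball covers the ball of radius \<open>(1 - k) * \<rho>\<close> about the image of \<open>m\<close>, and the convex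
  combination of the two images deviates from that point only by a Taylor remainder, which is
  quadratic as well.\<close>

lemma convex_image_lipschitz_perturbation_ball:
  fixes \<phi> :: "'a::{real_inner,banach} \<Rightarrow> 'a" and \<phi>' :: "'a \<Rightarrow> 'a \<Rightarrow> 'a"
  assumes k: "0 \<le> k" "k < 1" and r: "0 < r"
    and lip: "\<And>x y. x \<in> ball 0 r \<Longrightarrow> y \<in> ball 0 r \<Longrightarrow> norm (\<phi> x - \<phi> y) \<le> k * norm (x - y)"
    and lin: "\<And>m. linear (\<phi>' m)"
    and taylor: "\<And>x m. x \<in> ball 0 r \<Longrightarrow> m \<in> ball 0 r \<Longrightarrow>
                   norm (\<phi> x - \<phi> m - \<phi>' m (x - m)) \<le> L * (norm (x - m))\<^sup>2"
    and L: "2 * L * r \<le> 1 - k"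
  shows "convex ((\<lambda>z. z + \<phi> z) ` ball 0 r)"
  unfolding convex_alt
proof (intro ballI allI impI)
  fix X Y and s :: real
  assume "X \<in> (\<lambda>z. z + \<phi> z) ` ball 0 r" "Y \<in> (\<lambda>z. z + \<phi> z) ` ball 0 r" and s: "0 \<le> s \<and> s \<le> 1"
  then obtain x y where x: "x \<in> ball 0 r" "X = x + \<phi> x" and y: "y \<in> ball 0 r" "Y = y + \<phi> y" by blast
  define m where "m = (1 - s) *\<^sub>R x + s *\<^sub>R y"
  define d where "d = norm (x - y)"
  define \<rho> where "\<rho> = s * (1 - s) * d\<^sup>2 / (2 * r)"
  have m: "m \<in> ball 0 r"
    using convexD_alt[OF convex_ball x(1) y(1)] s by (simp add: m_def)
  have \<rho>0: "0 \<le> \<rho>" using s r by (simp add: \<rho>_def)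
  have xm: "x - m = s *\<^sub>R (x - y)" and ym: "y - m = (1 - s) *\<^sub>R (y - x)"
    by (simp_all add: m_def algebra_simps)
  have norm_m: "(norm m)\<^sup>2 < r\<^sup>2 - 2 * r * \<rho>"
  proof -
    have "(norm m)\<^sup>2 = (1 - s) * (norm x)\<^sup>2 + s * (norm y)\<^sup>2 - s * (1 - s) * d\<^sup>2"
      unfolding m_def d_def power2_norm_eq_inner
      by (simp add: inner_simps inner_commute algebra_simps)
    moreover have "(1 - s) * (norm x)\<^sup>2 + s * (norm y)\<^sup>2 < r\<^sup>2"
    proof -
      have "(norm x)\<^sup>2 < r\<^sup>2" "(norm y)\<^sup>2 < r\<^sup>2"
        using x y by (auto intro: power_strict_mono)
      then show ?thesis using s by (intro convex_bound_lt) auto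
    qed
    moreover have "2 * r * \<rho> = s * (1 - s) * d\<^sup>2" using r by (simp add: \<rho>_def)
    ultimately show ?thesis by simp
  qed
  have sub: "cball m \<rho> \<subseteq> ball 0 r"
  proof -
    have "0 < r * (r - 2 * \<rho>)"
      using norm_m by (simp add: power2_eq_square algebra_simps) (smt (verit) zero_le_square)
    then have "0 \<le> r - \<rho>" using r \<rho>0 by (simp add: zero_less_mult_iff)
    moreover have "(norm m)\<^sup>2 < (r - \<rho>)\<^sup>2"
      using norm_m zero_le_power2[of \<rho>] unfolding power2_diff by linarith
    ultimately have "norm m < r - \<rho>"
      by (metis power2_less_imp_less)
    then have *: "norm m + \<rho> < r" by simp
    show ?thesis
    proof
      fix z assume "z \<in> cball m \<rho>"
      then have "norm (z - m) \<le> \<rho>" by (simp add: dist_norm norm_minus_commute)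
      then show "z \<in> ball 0 r"
        using * norm_triangle_sub[of z m] by simp
    qed
  qed
  define R where "R u = \<phi> u - \<phi> m - \<phi>' m (u - m)" for u
  have "(1 - s) *\<^sub>R X + s *\<^sub>R Y - (m + \<phi> m) = (1 - s) *\<^sub>R R x + s *\<^sub>R R y"
  proof -
    have "(1 - s) *\<^sub>R \<phi>' m (x - m) + s *\<^sub>R \<phi>' m (y - m)
        = \<phi>' m ((1 - s) *\<^sub>R (x - m) + s *\<^sub>R (y - m))"
      by (simp add: linear_add[OF lin] linear_scale[OF lin])
    also have "(1 - s) *\<^sub>R (x - m) + s *\<^sub>R (y - m) = 0"
      by (simp add: m_def algebra_simps)
    finally have "(1 - s) *\<^sub>R \<phi>' m (x - m) + s *\<^sub>R \<phi>' m (y - m) = 0"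
      by (simp add: linear_0[OF lin])
    then have "(1 - s) *\<^sub>R \<phi>' m (x - m) = - s *\<^sub>R \<phi>' m (y - m)"
      by (simp add: eq_neg_iff_add_eq_0)
    then show ?thesis
      by (simp add: R_def x(2) y(2) m_def scaleR_diff_right scaleR_add_right)
        (simp add: algebra_simps)
  qed
  also have "norm \<dots> \<le> (1 - s) * (L * (norm (x - m))\<^sup>2) + s * (L * (norm (y - m))\<^sup>2)"
    using s taylor[OF x(1) m] taylor[OF y(1) m]
    by (intro norm_triangle_le add_mono) (auto simp: R_def intro!: mult_left_mono)
  also have "\<dots> = L * (s * (1 - s) * d\<^sup>2)"
    using norm_minus_commute[of y x] s unfolding xm ym d_def
    by (simp add: power_mult_distrib) (simp add: algebra_simps power2_eq_square)
  also have "\<dots> = (2 * L * r) * \<rho>" using r by (simp add: \<rho>_def)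
  also have "\<dots> \<le> (1 - k) * \<rho>" using L \<rho>0 by (rule mult_right_mono)
  finally have "norm ((1 - s) *\<^sub>R X + s *\<^sub>R Y - (m + \<phi> m)) \<le> (1 - k) * \<rho>" .
  then have "\<exists>z\<in>cball m \<rho>. z + \<phi> z = (1 - s) *\<^sub>R X + s *\<^sub>R Y"
    using sub by (intro lipschitz_perturbation_covers_cball[OF k \<rho>0] lip) auto
  then obtain z where "z \<in> cball m \<rho>" "(1 - s) *\<^sub>R X + s *\<^sub>R Y = z + \<phi> z" by metis
  with sub show "(1 - s) *\<^sub>R X + s *\<^sub>R Y \<in> (\<lambda>z. z + \<phi> z) ` ball 0 r"
    by (intro image_eqI[of _ _ z]) auto
qed

section \<open>A derivative criterion for uniform convexity\<close>

lemma Re_divide_ge_minus_1: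
  fixes B M :: complex
  assumes "B \<noteq> 0" and "norm M \<le> norm (2 * B + M)"
  shows "Re (M / B) \<ge> -1"
proof -
  define m where "m = M / B"
  have "norm m * norm B \<le> norm (2 + m) * norm B"
    using assms by (simp add: m_def flip: norm_mult) (simp add: algebra_simps)
  then have "norm m \<le> norm (2 + m)" using assms by simp
  then have "(norm m)\<^sup>2 \<le> (norm (2 + m))\<^sup>2" by (intro power_mono) auto
  then show ?thesis
    unfolding m_def[symmetric] cmod_power2 by (simp add: power2_eq_square algebra_simps)
qed

text \<open>If \<open>\<gamma>' = \<rho> i e\<^sup>i\<^sup>t B(t)\<close> with \<open>\<rho> > 0\<close> and \<open>B\<close> in the right half-plane, then
  \<open>t + \<pi>/2 + Im (Ln B(t))\<close> is a continuous branch of the tangent argument; writing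
  \<open>B' = i M\<close>, its derivative is \<open>1 + Re (M / B)\<close>, so that the half-plane bound above
  expresses that the tangent does not turn back.\<close>

lemma convex_arc_if_tangent_turns_forward:
  fixes \<gamma> :: "real \<Rightarrow> complex"
  assumes \<rho>: "\<rho> > 0"
    and \<gamma>: "\<And>t. t \<in> {\<alpha>..\<beta>} \<Longrightarrow>
           (\<gamma> has_vector_derivative of_real \<rho> * (\<i> * cis t * B t)) (at t)"
    and B: "\<And>t. t \<in> {\<alpha>..\<beta>} \<Longrightarrow> (B has_vector_derivative \<i> * M t) (at t)"
    and Re: "\<And>t. t \<in> {\<alpha>..\<beta>} \<Longrightarrow> Re (B t) > 0"
    and le: "\<And>t. t \<in> {\<alpha>..\<beta>} \<Longrightarrow> norm (M t) \<le> norm (2 * B t + M t)"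
  shows "convex_arc \<gamma> \<alpha> \<beta>"
proof -
  define \<theta> where "\<theta> t = t + pi / 2 + Im (Ln (B t))" for t
  have \<theta>': "(\<theta> has_real_derivative 1 + Re (M t / B t)) (at t)" if t: "t \<in> {\<alpha>..\<beta>}" for t
  proof -
    have nz: "B t \<noteq> 0" "B t \<notin> \<real>\<^sub>\<le>\<^sub>0" using Re[OF t] by (auto simp: complex_nonpos_Reals_iff)
    have "((\<lambda>t. Ln (B t)) has_vector_derivative (\<i> * M t) * (1 / B t)) (at t)"
      using field_vector_diff_chain_at[OF B[OF t], of Ln "1 / B t"] has_field_derivative_Ln[OF nz(2)]
      by (simp add: o_def field_simps)
    then have "((\<lambda>t. Im (Ln (B t))) has_real_derivative Im ((\<i> * M t) * (1 / B t))) (at t)"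
      by (simp add: has_vector_derivative_complex_iff)
    also have "Im ((\<i> * M t) * (1 / B t)) = Re (M t / B t)"
      by (metis Im_i_times mult.assoc mult.right_neutral times_divide_eq_right)
    finally show ?thesis
      unfolding \<theta>_def by (rule DERIV_add[rotated]) (auto intro!: derivative_eq_intros)
  qed
  have "continuous_on {\<alpha>..\<beta>} \<theta>"
    using \<theta>' by (meson DERIV_continuous_on DERIV_subset top_greatest)
  moreover have "mono_on {\<alpha>..\<beta>} \<theta>"
  proof (rule mono_onI)
    fix t u assume tu: "t \<in> {\<alpha>..\<beta>}" "u \<in> {\<alpha>..\<beta>}" "t \<le> u"
    show "\<theta> t \<le> \<theta> u"
    proof (rule DERIV_nonneg_imp_nondecreasing[OF tu(3)])
      fix v assume "t \<le> v" "v \<le> u"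
      then have v: "v \<in> {\<alpha>..\<beta>}" using tu by auto
      have "B v \<noteq> 0" using Re[OF v] by auto
      from Re_divide_ge_minus_1[OF this le[OF v]] \<theta>'[OF v]
      show "\<exists>y. (\<theta> has_real_derivative y) (at v) \<and> 0 \<le> y" by fastforce
    qed
  qed
  moreover have "\<exists>s>0. (\<gamma> has_vector_derivative s *\<^sub>R cis (\<theta> t)) (at t within {\<alpha>..\<beta>})"
    if t: "t \<in> {\<alpha>..\<beta>}" for t
  proof -
    have nz: "B t \<noteq> 0" using Re[OF t] by auto
    have "cis (\<theta> t) = cis t * \<i> * sgn (B t)"
      using nz by (simp add: \<theta>_def cis_mult[symmetric] Arg_eq_Im_Ln[symmetric] cis_Arg)
    then have "(\<rho> * norm (B t)) *\<^sub>R cis (\<theta> t) = of_real \<rho> * (\<i> * cis t * B t)"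
      using nz by (simp add: sgn_div_norm scaleR_conv_of_real)
    then show ?thesis
      using \<rho> nz \<gamma>[OF t] by (intro exI[of _ "\<rho> * norm (B t)"]) (auto intro: has_vector_derivative_at_within)
  qed
  ultimately show ?thesis unfolding convex_arc_def by blast
qed

text \<open>The criterion itself. Its last hypothesis is \<open>\<bar>g'\<bar> + 2 \<bar>h''\<bar> + 2 \<bar>g''\<bar> \<le> \<bar>h'\<bar>\<close> made uniform
  over the disc. For arcs the factor \<open>2\<close> is the diameter of the disc, which bounds the radius of the
  arc; for discs about the origin it is the constant in Polyak's principle.\<close>

lemma UK_H_if_derivative_bounds:
  fixes h g :: "complex \<Rightarrow> complex"
  assumes hol: "h holomorphic_on \<D>" "g holomorphic_on \<D>"
    and norm: "h 0 = 0" "deriv h 0 = 1" "g 0 = 0"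
    and k1: "\<And>z. z \<in> \<D> \<Longrightarrow> norm (deriv h z - 1) \<le> k1"
    and k2: "\<And>z. z \<in> \<D> \<Longrightarrow> norm (deriv g z) \<le> k2"
    and l1: "\<And>z. z \<in> \<D> \<Longrightarrow> norm (deriv (deriv h) z) \<le> l1"
    and l2: "\<And>z. z \<in> \<D> \<Longrightarrow> norm (deriv (deriv g) z) \<le> l2"
    and k: "k1 + k2 < 1" and kl: "k1 + k2 + 2 * (l1 + l2) \<le> 1"
  shows "(\<lambda>z. h z + cnj (g z)) \<in> UK_H"
proof -
  define F where "F z = h z + cnj (g z)" for z
  define \<phi> where "\<phi> z = (h z - z) + cnj (g z)" for z
  have F_\<phi>: "F = (\<lambda>z. z + \<phi> z)" by (simp add: F_def \<phi>_def fun_eq_iff)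
  have nonneg: "0 \<le> k1" "0 \<le> k2" "0 \<le> l1" "0 \<le> l2"
    using order_trans[OF norm_ge_zero k1[of 0]] order_trans[OF norm_ge_zero k2[of 0]]
      order_trans[OF norm_ge_zero l1[of 0]] order_trans[OF norm_ge_zero l2[of 0]] by simp_all
  have hol': "deriv h holomorphic_on \<D>" "deriv g holomorphic_on \<D>"
    using hol by (auto intro: holomorphic_deriv)
  note D = holomorphic_derivI[OF hol(1) open_ball] holomorphic_derivI[OF hol(2) open_ball]
    holomorphic_derivI[OF hol'(1) open_ball] holomorphic_derivI[OF hol'(2) open_ball]
  have canonical: "canonical_decomp F h g"
    using hol norm by (simp add: canonical_decomp_def F_def)

  have lip: "norm (\<phi> x - \<phi> y) \<le> (k1 + k2) * norm (x - y)" if "x \<in> \<D>" "y \<in> \<D>" for x y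
  proof -
    have "norm ((h x - x) - (h y - y)) \<le> k1 * norm (x - y)"
      by (rule field_differentiable_bound[OF convex_ball _ k1 that])
        (auto intro!: derivative_eq_intros D)
    moreover have "norm (g x - g y) \<le> k2 * norm (x - y)"
      by (rule field_differentiable_bound[OF convex_ball _ k2 that]) (auto intro!: D)
    then have "norm (cnj (g x) - cnj (g y)) \<le> k2 * norm (x - y)"
      by (simp flip: complex_cnj_diff)
    ultimately show ?thesis
      using norm_triangle_ineq[of "(h x - x) - (h y - y)" "cnj (g x) - cnj (g y)"]
      unfolding \<phi>_def by (simp add: algebra_simps)
  qed
  have inj: "inj_on F \<D>"
  proof (rule inj_onI)
    fix x y assume xy: "x \<in> \<D>" "y \<in> \<D>" "F x = F y"
    then have "x + \<phi> x = y + \<phi> y" by (simp add: F_\<phi>)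
    then have "x - y = \<phi> y - \<phi> x" by (metis add_diff_cancel_right add_diff_cancel_left add.commute diff_add_eq)
    then have "norm (x - y) = norm (\<phi> y - \<phi> x)" by (rule arg_cong)
    with lip[OF xy(2,1)] have "(1 - (k1 + k2)) * norm (x - y) \<le> 0"
      by (simp add: norm_minus_commute algebra_simps)
    then show "x = y" using k by (simp add: mult_le_0_iff)
  qed
  have bounds: "norm (deriv h z) \<ge> 1 - k1" if "z \<in> \<D>" for z
    using k1[OF that] norm_triangle_ineq2[of 1 "1 - deriv h z"] by (simp add: norm_minus_commute)
  have jacobian: "(norm (deriv h z))\<^sup>2 - (norm (deriv g z))\<^sup>2 > 0" if "z \<in> \<D>" for z
    using bounds[OF that] k2[OF that] k
    by (simp add: power_strict_mono)
  have S_H: "F \<in> S_H"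
    unfolding S_H_def using inj canonical jacobian by blast

  have convex: "convex (F ` ball 0 r)" if r: "r \<in> {0<..<1}" for r
  proof -
    define \<phi>' where "\<phi>' m v = (deriv h m - 1) * v + cnj (deriv g m * v)" for m v
    have second_order: "norm (u x - u m - deriv u m * (x - m)) \<le> l * (norm (x - m))\<^sup>2"
      if u: "u holomorphic_on \<D>" and l: "\<And>z. z \<in> \<D> \<Longrightarrow> norm (deriv (deriv u) z) \<le> l"
        and xm: "x \<in> \<D>" "m \<in> \<D>" for u l x m
    proof -
      have *: "((deriv ^^ i) u has_field_derivative (deriv ^^ Suc i) u z) (at z within \<D>)"
        if "z \<in> \<D>" for i z
        using holomorphic_derivI[OF holomorphic_higher_deriv[OF u open_ball] open_ball that]
        by simp
      have "norm ((deriv ^^ 0) u x - (\<Sum>i\<le>1. (deriv ^^ i) u m * (x - m) ^ i / fact i))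
            \<le> l * norm (x - m) ^ Suc 1 / fact 1"
        by (rule complex_Taylor[where f = "\<lambda>i. (deriv ^^ i) u" and S = \<D>, OF convex_ball * _ xm(2,1)])
          (use l in simp_all)
      then show ?thesis by (simp add: algebra_simps power2_eq_square)
    qed
    have "convex ((\<lambda>z. z + \<phi> z) ` ball 0 r)"
    proof (rule convex_image_lipschitz_perturbation_ball[where k = "k1 + k2" and L = "l1 + l2" and \<phi>' = \<phi>'])
      show "0 \<le> k1 + k2" "k1 + k2 < 1" "0 < r" using nonneg k r by auto
      show "norm (\<phi> x - \<phi> y) \<le> (k1 + k2) * norm (x - y)" if "x \<in> ball 0 r" "y \<in> ball 0 r" for x y
        using that r by (intro lip) auto
      show "linear (\<phi>' m)" for m
        by (rule linearI) (simp_all add: \<phi>'_def algebra_simps)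
      show "norm (\<phi> x - \<phi> m - \<phi>' m (x - m)) \<le> (l1 + l2) * (norm (x - m))\<^sup>2"
        if "x \<in> ball 0 r" "m \<in> ball 0 r" for x m
      proof -
        have xm: "x \<in> \<D>" "m \<in> \<D>" using that r by auto
        have "\<phi> x - \<phi> m - \<phi>' m (x - m) = (h x - h m - deriv h m * (x - m))
                + cnj (g x - g m - deriv g m * (x - m))"
          by (simp add: \<phi>_def \<phi>'_def algebra_simps)
        also have "norm \<dots> \<le> l1 * (norm (x - m))\<^sup>2 + l2 * (norm (x - m))\<^sup>2"
          by (intro norm_triangle_le add_mono)
            (simp_all only: complex_mod_cnj second_order[OF hol(1) l1 xm] second_order[OF hol(2) l2 xm])
        finally show ?thesis by (simp add: algebra_simps)
      qed
      have "2 * (l1 + l2) * r \<le> 2 * (l1 + l2) * 1"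
        using r nonneg by (intro mult_left_mono) auto
      then show "2 * (l1 + l2) * r \<le> 1 - (k1 + k2)" using kl by simp
    qed
    then show ?thesis by (simp add: F_\<phi>)
  qed
  have "open (F ` ball 0 r)" if "r \<in> {0<..<1}" for r
    unfolding F_\<phi> using that nonneg k
    by (intro open_image_lipschitz_perturbation[of "k1 + k2"] lip) auto
  moreover have "locally_univalent F"
    unfolding locally_univalent_def using inj
    by (metis inf_le2 inj_on_subset zero_less_one)
  ultimately have fully_convex: "fully_convex F"
    using convex canonical by (auto simp: fully_convex_def harmonic_class_def)

  have arcs: "convex_arc (\<lambda>t. F (c + of_real \<rho> * cis t)) \<alpha> \<beta>"
    if c: "c \<in> \<D>" and \<rho>: "\<rho> > 0" and in_disc: "\<forall>t\<in>{\<alpha>..\<beta>}. c + of_real \<rho> * cis t \<in> \<D>"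
    for c \<rho> \<alpha> \<beta>
  proof -
    define z where "z t = c + of_real \<rho> * cis t" for t
    define w where "w t = of_real \<rho> * cis t" for t
    define u where "u t = cis (- 2 * t)" for t
    define B where "B t = deriv h (z t) - u t * cnj (deriv g (z t))" for t
    define M where "M t = w t * deriv (deriv h) (z t) + 2 * u t * cnj (deriv g (z t))
                           + u t * cnj (w t * deriv (deriv g) (z t))" for t
    have z': "(z has_vector_derivative \<i> * w t) (at t)" for t
      unfolding z_def w_def has_vector_derivative_def
      by (auto intro!: derivative_eq_intros simp: fun_eq_iff scaleR_conv_of_real)
    have u': "(u has_vector_derivative - 2 * \<i> * u t) (at t)" for t
      unfolding u_def has_vector_derivative_def
      by (auto intro!: derivative_eq_intros simp: fun_eq_iff scaleR_conv_of_real)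
    have zD: "z t \<in> \<D>" if "t \<in> {\<alpha>..\<beta>}" for t
      using in_disc that by (auto simp: z_def)
    have chain: "((\<lambda>t. q (z t)) has_vector_derivative \<i> * w t * deriv q (z t)) (at t)"
      if "t \<in> {\<alpha>..\<beta>}" "q holomorphic_on \<D>" for t q
      using field_vector_diff_chain_at[OF z' holomorphic_derivI[OF that(2) open_ball zD[OF that(1)]]]
      by (simp add: o_def)
    have norm_u: "norm (u t) = 1" for t by (simp add: u_def)
    have norm_w: "norm (w t) \<le> 2" if "t \<in> {\<alpha>..\<beta>}" for t
      using norm_triangle_ineq4[of "z t" c] zD[OF that] c by (simp add: z_def w_def)
    have "convex_arc (\<lambda>t. F (z t)) \<alpha> \<beta>"
    proof (rule convex_arc_if_tangent_turns_forward[OF \<rho>, of _ _ _ B M])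
      fix t assume t: "t \<in> {\<alpha>..\<beta>}"
      note zt = zD[OF t]
      have cis_u: "cis t * u t = cnj (cis t)"
        unfolding u_def cis_mult cis_cnj by simp
      have "((\<lambda>t. F (z t)) has_vector_derivative
               \<i> * w t * deriv h (z t) + cnj (\<i> * w t * deriv g (z t))) (at t)"
        unfolding F_def by (intro has_vector_derivative_add has_vector_derivative_cnj chain t hol)
      also have "\<i> * w t * deriv h (z t) + cnj (\<i> * w t * deriv g (z t))
          = of_real \<rho> * (\<i> * cis t * deriv h (z t) - \<i> * cnj (cis t) * cnj (deriv g (z t)))"
        by (simp add: w_def algebra_simps)
      also have "\<dots> = of_real \<rho> * (\<i> * cis t * B t)"
        unfolding B_def cis_u[symmetric] by (simp add: algebra_simps)
      finally show "((\<lambda>t. F (z t)) has_vector_derivative of_real \<rho> * (\<i> * cis t * B t)) (at t)" .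
      have "(B has_vector_derivative \<i> * w t * deriv (deriv h) (z t)
              - (u t * cnj (\<i> * w t * deriv (deriv g) (z t)) + (- 2 * \<i> * u t) * cnj (deriv g (z t)))) (at t)"
        unfolding B_def
        by (intro has_vector_derivative_diff has_vector_derivative_mult has_vector_derivative_cnj
            chain t hol' u')
      then show "(B has_vector_derivative \<i> * M t) (at t)"
        by (rule has_vector_derivative_eq_rhs) (simp add: M_def algebra_simps)
      have "Re (B t) = 1 - Re ((1 - deriv h (z t)) + u t * cnj (deriv g (z t)))"
        by (simp add: B_def)
      moreover have "norm ((1 - deriv h (z t)) + u t * cnj (deriv g (z t))) \<le> k1 + k2"
        using k1[OF zt] k2[OF zt]
        by (intro norm_triangle_le add_mono) (auto simp: norm_mult norm_u norm_minus_commute)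
      ultimately show "Re (B t) > 0"
        using complex_Re_le_cmod[of "(1 - deriv h (z t)) + u t * cnj (deriv g (z t))"] k by linarith
      \<comment> \<open>The terms in \<open>g'\<close> cancel in \<open>2 * B + M\<close>, so \<open>k2\<close> enters the criterion with weight \<open>1\<close> only.\<close>
      have sum: "2 * B t + M t = 2 * deriv h (z t)
          + (w t * deriv (deriv h) (z t) + u t * cnj (w t * deriv (deriv g) (z t)))"
        by (simp add: B_def M_def)
      have second: "norm (w t * deriv (deriv h) (z t) + u t * cnj (w t * deriv (deriv g) (z t)))
          \<le> 2 * l1 + 2 * l2"
        using l1[OF zt] l2[OF zt] norm_w[OF t]
        by (intro norm_triangle_le add_mono) (auto simp: norm_mult norm_u intro!: mult_mono)
      have "norm (M t) \<le> norm (w t * deriv (deriv h) (z t) + u t * cnj (w t * deriv (deriv g) (z t)))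
          + norm (2 * u t * cnj (deriv g (z t)))"
        by (rule order_trans[OF _ norm_triangle_ineq]) (simp add: M_def add_ac)
      also have "\<dots> \<le> 2 * l1 + 2 * l2 + 2 * k2"
        using second k2[OF zt] by (intro add_mono) (auto simp: norm_mult norm_u)
      also have "\<dots> \<le> 2 * (1 - k1) - (2 * l1 + 2 * l2)"
        using kl by simp
      also have "\<dots> \<le> norm (2 * deriv h (z t))
          - norm (w t * deriv (deriv h) (z t) + u t * cnj (w t * deriv (deriv g) (z t)))"
        using second bounds[OF zt] by (simp add: norm_mult)
      also have "\<dots> \<le> norm (2 * B t + M t)"
        unfolding sum by (rule norm_diff_ineq)
      finally show "norm (M t) \<le> norm (2 * B t + M t)" .
    qed
    then show ?thesis by (simp add: z_def)
  qed
  have "uniformly_convex F"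
    unfolding uniformly_convex_def using fully_convex arcs by blast
  with S_H have "F \<in> UK_H" by (simp add: UK_H_def)
  then show ?thesis by (simp add: F_def[abs_def])
qed

section \<open>The coefficient condition\<close>

lemma power_series_deriv_on_disc:
  fixes p :: "nat \<Rightarrow> complex"
  assumes sums: "\<And>z. z \<in> \<D> \<Longrightarrow> (\<lambda>n. p n * z ^ n) sums u z"
  shows "u holomorphic_on \<D>"
    and "\<And>z. z \<in> \<D> \<Longrightarrow> (\<lambda>n. diffs p n * z ^ n) sums deriv u z"
proof -
  have "u field_differentiable at z" if z: "z \<in> \<D>" for z
  proof -
    have "((\<lambda>z. \<Sum>n. p n * z ^ n) has_field_derivative (\<Sum>n. diffs p n * z ^ n)) (at z)"
      using z by (intro termdiffs_strong'[of 1] sums_summable[OF sums]) auto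
    then have "(u has_field_derivative (\<Sum>n. diffs p n * z ^ n)) (at z)"
      by (rule has_field_derivative_transform_within_open[OF _ open_ball z])
        (use sums in \<open>auto simp: sums_iff\<close>)
    then show ?thesis by (auto simp: field_differentiable_def)
  qed
  then show hol: "u holomorphic_on \<D>"
    by (auto simp: holomorphic_on_def intro: field_differentiable_at_within)
  show "(\<lambda>n. diffs p n * z ^ n) sums deriv u z" if "z \<in> \<D>" for z
    by (rule termdiffs_sums_strong[where K = 1, OF sums holomorphic_derivI[OF hol open_ball that]])
      (use that in auto)
qed

lemma norm_power_series_le:
  fixes p :: "nat \<Rightarrow> complex"
  assumes "(\<lambda>n. p n * z ^ n) sums s" and z: "z \<in> \<D>" and "(\<lambda>n. norm (p n)) sums S"
  shows "norm s \<le> S"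
proof -
  have le: "norm (p n * z ^ n) \<le> norm (p n)" for n
    using z by (simp add: norm_mult norm_power power_le_one mult_left_le)
  show ?thesis
    using norm_suminf_le[OF le sums_summable[OF assms(3)]] assms(1,3) by (simp add: sums_iff)
qed

lemma norm_deriv_power_series_le:
  fixes p :: "nat \<Rightarrow> complex"
  assumes sums: "\<And>z. z \<in> \<D> \<Longrightarrow> (\<lambda>n. p n * z ^ n) sums u z" and z: "z \<in> \<D>"
  shows "(\<lambda>n. real n * norm (p n)) sums k \<Longrightarrow> norm (deriv u z) \<le> k"
    and "(\<lambda>n. real n * (real n - 1) * norm (p n)) sums l \<Longrightarrow> norm (deriv (deriv u) z) \<le> l"
proof -
  have s1: "(\<lambda>n. diffs p n * z ^ n) sums deriv u z" if "z \<in> \<D>" for z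
    using power_series_deriv_on_disc(2)[OF sums that] .
  have s2: "(\<lambda>n. diffs (diffs p) n * z ^ n) sums deriv (deriv u) z" if "z \<in> \<D>" for z
    using power_series_deriv_on_disc(2)[OF s1 that] .
  show "norm (deriv u z) \<le> k" if "(\<lambda>n. real n * norm (p n)) sums k"
  proof (rule norm_power_series_le[OF s1[OF z] z])
    have "(\<lambda>n. real (Suc n) * norm (p (Suc n))) sums k"
      using that by (subst sums_Suc_iff) simp
    then show "(\<lambda>n. norm (diffs p n)) sums k"
      by (simp add: diffs_def norm_mult del: of_nat_Suc)
  qed
  show "norm (deriv (deriv u) z) \<le> l" if "(\<lambda>n. real n * (real n - 1) * norm (p n)) sums l"
  proof (rule norm_power_series_le[OF s2[OF z] z])
    have "(\<lambda>n. real (Suc n) * (real (Suc n) - 1) * norm (p (Suc n))) sums l"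
      using that by (subst sums_Suc_iff) simp
    then have "(\<lambda>n. real (Suc (Suc n)) * (real (Suc (Suc n)) - 1) * norm (p (Suc (Suc n)))) sums l"
      by (subst sums_Suc_iff) simp
    then show "(\<lambda>n. norm (diffs (diffs p) n)) sums l"
      by (simp add: diffs_def norm_mult mult_ac del: of_nat_Suc) (simp add: mult_ac add_ac)
  qed
qed

text \<open>The harmonic counterpart of Goodman's condition \<open>\<Sum>n(2n-1)|a\<^sub>n| \<le> 1\<close>: the weight is
  \<open>n(2n-1) = n + 2n(n-1)\<close>, the first derivatives contributing \<open>n\<close> and the second ones, doubled,
  the rest. Here \<open>p\<close> is the coefficient sequence of \<open>h - id\<close>. The separate bound on
  \<open>\<Sum>n(|p\<^sub>n| + |q\<^sub>n|)\<close> excludes degenerate cases such as \<open>z + cnj z\<close>.\<close>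

lemma UK_H_if_coefficient_sum:
  fixes h g :: "complex \<Rightarrow> complex" and p q :: "nat \<Rightarrow> complex"
  assumes h: "\<And>z. z \<in> \<D> \<Longrightarrow> (\<lambda>n. p n * z ^ n) sums (h z - z)" and p: "p 0 = 0" "p 1 = 0"
    and g: "\<And>z. z \<in> \<D> \<Longrightarrow> (\<lambda>n. q n * z ^ n) sums g z" and q: "q 0 = 0"
    and k: "summable (\<lambda>n. real n * (norm (p n) + norm (q n)))"
      "(\<Sum>n. real n * (norm (p n) + norm (q n))) < 1"
    and l: "summable (\<lambda>n. real n * (2 * real n - 1) * (norm (p n) + norm (q n)))"
      "(\<Sum>n. real n * (2 * real n - 1) * (norm (p n) + norm (q n))) \<le> 1"
  shows "(\<lambda>z. h z + cnj (g z)) \<in> UK_H"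
proof -
  have l0: "0 \<le> real n * (real n - 1)" for n :: nat
    by (cases n) auto
  have summ: "summable (\<lambda>n. real n * x n)" "summable (\<lambda>n. real n * (real n - 1) * x n)"
    if x: "\<And>n. 0 \<le> x n" "\<And>n. x n \<le> norm (p n) + norm (q n)" for x
  proof -
    have "real n * (real n - 1) * x n \<le> real n * (2 * real n - 1) * (norm (p n) + norm (q n))" for n
      using x by (cases n) (auto intro!: mult_mono)
    then show "summable (\<lambda>n. real n * (real n - 1) * x n)"
      by (intro summable_comparison_test'[OF l(1), of 0]) (simp add: abs_of_nonneg l0 x)
    show "summable (\<lambda>n. real n * x n)"
      by (rule summable_comparison_test'[OF k(1), of 0]) (use x in \<open>auto intro!: mult_left_mono\<close>)
  qed
  define k1 where "k1 = (\<Sum>n. real n * norm (p n))"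
  define k2 where "k2 = (\<Sum>n. real n * norm (q n))"
  define l1 where "l1 = (\<Sum>n. real n * (real n - 1) * norm (p n))"
  define l2 where "l2 = (\<Sum>n. real n * (real n - 1) * norm (q n))"
  have sums: "(\<lambda>n. real n * norm (p n)) sums k1" "(\<lambda>n. real n * norm (q n)) sums k2"
    "(\<lambda>n. real n * (real n - 1) * norm (p n)) sums l1"
    "(\<lambda>n. real n * (real n - 1) * norm (q n)) sums l2"
    using summ[of "\<lambda>n. norm (p n)"] summ[of "\<lambda>n. norm (q n)"]
    by (simp_all add: k1_def k2_def l1_def l2_def summable_sums)
  have "(\<lambda>n. real n * (norm (p n) + norm (q n))) sums (k1 + k2)"
    using sums_add[OF sums(1,2)] by (simp add: distrib_left)
  with k have "k1 + k2 < 1" by (simp add: sums_iff)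
  have "(\<lambda>n. real n * (2 * real n - 1) * (norm (p n) + norm (q n))) sums (k1 + k2 + 2 * (l1 + l2))"
    using sums_add[OF sums_add[OF sums(1,2)] sums_mult[OF sums_add[OF sums(3,4)], of 2]]
    by (simp add: algebra_simps)
  with l have kl: "k1 + k2 + 2 * (l1 + l2) \<le> 1" by (simp add: sums_iff)

  have "(\<lambda>z. h z - z) holomorphic_on \<D>"
    by (rule power_series_deriv_on_disc(1)[OF h])
  then have "(\<lambda>z. (h z - z) + z) holomorphic_on \<D>"
    by (rule holomorphic_on_add) (rule holomorphic_on_ident)
  then have hol_h: "h holomorphic_on \<D>" by simp
  have hol_g: "g holomorphic_on \<D>"
    by (rule power_series_deriv_on_disc(1)[OF g])
  have deriv1: "deriv (\<lambda>z. h z - z) z = deriv h z - 1" if "z \<in> \<D>" for z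
    by (rule DERIV_imp_deriv) (auto intro!: derivative_eq_intros holomorphic_derivI[OF hol_h open_ball that])
  have deriv2: "deriv (deriv (\<lambda>z. h z - z)) z = deriv (deriv h) z" if z: "z \<in> \<D>" for z
  proof -
    have "deriv h holomorphic_on \<D>" by (rule holomorphic_deriv[OF hol_h open_ball])
    then have "((\<lambda>z. deriv h z - 1) has_field_derivative deriv (deriv h) z) (at z)"
      by (auto intro!: derivative_eq_intros holomorphic_derivI[OF _ open_ball z])
    then have "(deriv (\<lambda>z. h z - z) has_field_derivative deriv (deriv h) z) (at z)"
      by (rule has_field_derivative_transform_within_open[OF _ open_ball z]) (simp add: deriv1)
    then show ?thesis by (rule DERIV_imp_deriv)
  qed
  have zero: "c 0 = x" if "(\<lambda>n. c n * 0 ^ n) sums x" for c :: "nat \<Rightarrow> complex" and x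
    using that sums_unique2[OF that powser_sums_zero] by auto
  show ?thesis
  proof (rule UK_H_if_derivative_bounds[OF hol_h hol_g])
    show "h 0 = 0" using zero[OF h[of 0]] p by simp
    show "g 0 = 0" using zero[OF g[of 0]] q by simp
    have "diffs p 0 = deriv (\<lambda>z. h z - z) 0"
      by (rule zero, rule power_series_deriv_on_disc(2)[OF h]) auto
    then show "deriv h 0 = 1" using p by (simp add: deriv1 diffs_def)
    fix z assume z: "z \<in> \<D>"
    show "norm (deriv h z - 1) \<le> k1" "norm (deriv (deriv h) z) \<le> l1"
      using norm_deriv_power_series_le[OF h z] sums z by (simp_all add: deriv1 deriv2)
    show "norm (deriv g z) \<le> k2" "norm (deriv (deriv g) z) \<le> l2"
      using norm_deriv_power_series_le[OF g z] sums by simp_all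
  qed fact+
qed

text \<open>Clearing denominators, the claim is that \<open>2n\<^sup>2 - 2n(ab + 1) + 3ab + a + b + 1\<close> is nonnegative
  for \<open>n \<ge> 1\<close>. The second alternative says that the discriminant of this quadratic is not
  positive; under the first one the vertex \<open>(ab + 1)/2\<close> is at most \<open>2\<close> and the value at \<open>2\<close> is
  nonnegative. For \<open>n = 1\<close> the claim is trivial.\<close>

lemma integral_multiplier_le:
  fixes a b :: real and n :: nat
  assumes a: "a > -1" and b: "b > -1" and n: "n \<ge> 1"
    and ab: "a * b \<le> 3 \<or> a\<^sup>2 * b\<^sup>2 - 4 * a * b - 2 * (a + b) \<le> 1"
  shows "(2 * real n - 1) * ((a + 1) * (b + 1) / ((a + n) * (b + n))) \<le> 2"
proof -
  define x where "x = real n"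
  have x1: "x \<ge> 1" using n by (simp add: x_def)
  have "(2 * x - 1) * ((a + 1) * (b + 1)) \<le> 2 * ((a + x) * (b + x))"
  proof (cases "n = 1")
    case True
    have "0 \<le> (a + 1) * (b + 1)" using a b by simp
    then show ?thesis using True by (simp add: x_def)
  next
    case False
    have "0 \<le> 2 * x\<^sup>2 - 2 * x * (a * b + 1) + 3 * (a * b) + a + b + 1"
      using ab
    proof
      assume le: "a * b \<le> 3"
      have "0 \<le> (x - 2) * (x + 1 - a * b)"
      proof (cases "n = 2")
        case True
        then show ?thesis by (simp add: x_def)
      next
        case F: False
        then have "x \<ge> 3" using False n by (simp add: x_def)
        then show ?thesis using le by simp
      qed
      moreover have "0 \<le> 5 - a * b + a + b" using le a b by linarith
      moreover have "2 * x\<^sup>2 - 2 * x * (a * b + 1) + 3 * (a * b) + a + b + 1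
          = 2 * ((x - 2) * (x + 1 - a * b)) + (5 - a * b + a + b)"
        by (simp add: algebra_simps power2_eq_square)
      ultimately show ?thesis by linarith
    next
      assume le: "a\<^sup>2 * b\<^sup>2 - 4 * a * b - 2 * (a + b) \<le> 1"
      have "2 * (2 * x\<^sup>2 - 2 * x * (a * b + 1) + 3 * (a * b) + a + b + 1)
          = (2 * x - (a * b + 1))\<^sup>2 + (1 - (a\<^sup>2 * b\<^sup>2 - 4 * a * b - 2 * (a + b)))"
        by (simp add: algebra_simps power2_eq_square)
      moreover have "0 \<le> (2 * x - (a * b + 1))\<^sup>2 + (1 - (a\<^sup>2 * b\<^sup>2 - 4 * a * b - 2 * (a + b)))"
        using le by (intro add_nonneg_nonneg) auto
      ultimately have "0 \<le> 2 * (2 * x\<^sup>2 - 2 * x * (a * b + 1) + 3 * (a * b) + a + b + 1)" by argo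
      then show ?thesis by simp
    qed
    then show ?thesis by (simp add: algebra_simps power2_eq_square)
  qed
  moreover have "0 < (a + x) * (b + x)" using a b x1 by simp
  ultimately show ?thesis unfolding x_def by (simp add: divide_le_eq)
qed

theorem theorem5:
  fixes f h g :: "complex \<Rightarrow> complex" and A B :: "nat \<Rightarrow> complex" and a b :: real
  assumes "canonical_decomp f h g"
    and "\<And>z. z \<in> \<D> \<Longrightarrow> ((\<lambda>n. A n * z ^ n) has_sum (h z - z)) {2..}"
    and "\<And>z. z \<in> \<D> \<Longrightarrow> ((\<lambda>n. B n * z ^ n) has_sum g z) {1..}"
    and "(\<lambda>n. real n * norm (A n)) summable_on {2..}"
    and "(\<lambda>n. real n * norm (B n)) summable_on {1..}"
    and "(\<Sum>\<^sub>\<infinity>n\<in>{2..}. real n * norm (A n)) + (\<Sum>\<^sub>\<infinity>n\<in>{1..}. real n * norm (B n)) \<le> 1 / 2"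
    and "a > -1" and "b > -1"
    and "a * b \<le> 3 \<or> (a * b > 3 \<and> a\<^sup>2 * b\<^sup>2 - 4 * a * b - 2 * (a + b) \<le> 1)"
  shows "(\<lambda>z. H_op a b h z + cnj (H_op a b g z)) \<in> UK_H"
proof -
  define c where "c n = (a + 1) * (b + 1) / ((a + real n) * (b + real n))" for n :: nat
  have c0: "0 \<le> c n" and c1: "c n \<le> 1" if "n \<ge> 1" for n
  proof -
    have n: "1 \<le> real n" using that by simp
    then have pos: "0 < (a + real n) * (b + real n)" using assms(7,8) by simp
    show "0 \<le> c n" using pos assms(7,8) by (simp add: c_def)
    have "(a + 1) * (b + 1) \<le> (a + real n) * (b + real n)"
      using n assms(7,8) by (intro mult_mono) auto
    then show "c n \<le> 1" using pos by (simp add: c_def)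
  qed
  have c2: "(2 * real n - 1) * c n \<le> 2" if "n \<ge> 1" for n
    unfolding c_def using assms(7-9) that by (intro integral_multiplier_le) auto
  have c_1: "c 1 = 1" using assms(7,8) by (simp add: c_def)

  define p where "p n = (if n \<ge> 2 then of_real (c n) * A n else 0)" for n
  define q where "q n = (if n \<ge> 1 then of_real (c n) * B n else 0)" for n
  have p_sums: "(\<lambda>n. p n * z ^ n) sums (H_op a b h z - z)" if z: "z \<in> \<D>" for z
  proof -
    define A' where "A' n = (if n = 1 then 1 else A n)" for n :: nat
    have "((\<lambda>n. A' n * z ^ n) has_sum h z) {1..}" if "z \<in> \<D>" for z
    proof -
      have "((\<lambda>n. A' n * z ^ n) has_sum (h z - z)) {2..}"
        using assms(2)[OF that] by (rule has_sum_cong[THEN iffD1, rotated]) (auto simp: A'_def)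
      moreover have "((\<lambda>n. A' n * z ^ n) has_sum z) {1}"
        by (rule has_sum_finiteI) (auto simp: A'_def)
      ultimately have "((\<lambda>n. A' n * z ^ n) has_sum (z + (h z - z))) ({1} \<union> {2..})"
        by (intro has_sum_Un_disjoint) auto
      moreover have "{1} \<union> {2..} = {1::nat..}" by auto
      ultimately show ?thesis by simp
    qed
    from H_op_series[OF assms(7,8) this z]
    have "((\<lambda>n. of_real (c n) * A' n * z ^ n) has_sum H_op a b h z) {1..}"
      by (simp add: c_def)
    moreover have "((\<lambda>n. of_real (c n) * A' n * z ^ n) has_sum z) {1}"
      by (rule has_sum_finiteI) (auto simp: A'_def c_1[unfolded One_nat_def])
    ultimately have "((\<lambda>n. of_real (c n) * A' n * z ^ n) has_sum (H_op a b h z - z)) ({1..} - {1})"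
      by (rule has_sum_Diff) auto
    then have "((\<lambda>n. p n * z ^ n) has_sum (H_op a b h z - z)) UNIV"
      by (rule has_sum_cong_neutral[THEN iffD1, rotated -1]) (auto simp: p_def A'_def)
    then show ?thesis by (rule has_sum_imp_sums)
  qed
  have q_sums: "(\<lambda>n. q n * z ^ n) sums H_op a b g z" if z: "z \<in> \<D>" for z
  proof -
    from H_op_series[OF assms(7,8,3) z]
    have "((\<lambda>n. of_real (c n) * B n * z ^ n) has_sum H_op a b g z) {1..}"
      by (simp add: c_def)
    then have "((\<lambda>n. q n * z ^ n) has_sum H_op a b g z) UNIV"
      by (rule has_sum_cong_neutral[THEN iffD1, rotated -1]) (auto simp: q_def)
    then show ?thesis by (rule has_sum_imp_sums)
  qed

  define \<sigma> where "\<sigma> n = (if n \<ge> 2 then real n * norm (A n) else 0)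
      + (if n \<ge> 1 then real n * norm (B n) else 0)" for n
  have "((\<lambda>n. if n \<ge> 2 then real n * norm (A n) else 0) has_sum
      (\<Sum>\<^sub>\<infinity>n\<in>{2..}. real n * norm (A n))) UNIV"
    using has_sum_infsum[OF assms(4)]
    by (rule has_sum_cong_neutral[THEN iffD1, rotated -1]) auto
  moreover have "((\<lambda>n. if n \<ge> 1 then real n * norm (B n) else 0) has_sum
      (\<Sum>\<^sub>\<infinity>n\<in>{1..}. real n * norm (B n))) UNIV"
    using has_sum_infsum[OF assms(5)]
    by (rule has_sum_cong_neutral[THEN iffD1, rotated -1]) auto
  ultimately have "\<sigma> sums ((\<Sum>\<^sub>\<infinity>n\<in>{2..}. real n * norm (A n)) + (\<Sum>\<^sub>\<infinity>n\<in>{1..}. real n * norm (B n)))"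
    unfolding \<sigma>_def by (intro sums_add has_sum_imp_sums)
  then have \<sigma>: "summable \<sigma>" "suminf \<sigma> \<le> 1 / 2" using assms(6) by (simp_all add: sums_iff)

  have pq: "real n * (norm (p n) + norm (q n)) = c n * \<sigma> n" for n
    using c0[of n] by (cases "n = 0") (auto simp: p_def q_def \<sigma>_def norm_mult algebra_simps)
  have \<sigma>0: "0 \<le> \<sigma> n" and \<sigma>_0: "\<sigma> 0 = 0" for n by (auto simp: \<sigma>_def)
  have first: "real n * (norm (p n) + norm (q n)) \<le> \<sigma> n" for n
    using mult_right_mono[OF c1 \<sigma>0] by (cases "n = 0") (simp_all add: pq \<sigma>_0)
  have second: "real n * (2 * real n - 1) * (norm (p n) + norm (q n)) \<le> 2 * \<sigma> n" for n
  proof (cases "n = 0")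
    case False
    have "real n * (2 * real n - 1) * (norm (p n) + norm (q n)) = ((2 * real n - 1) * c n) * \<sigma> n"
      using arg_cong[OF pq[of n], of "\<lambda>x. (2 * real n - 1) * x"] by (simp only: mult_ac)
    also have "\<dots> \<le> 2 * \<sigma> n"
      using c2[of n] \<sigma>0[of n] False by (intro mult_right_mono) auto
    finally show ?thesis .
  qed (simp add: \<sigma>_0)
  have nonneg: "0 \<le> real n * (2 * real n - 1)" for n :: nat by (cases n) auto
  have k: "summable (\<lambda>n. real n * (norm (p n) + norm (q n)))"
    by (rule summable_comparison_test'[OF \<sigma>(1), of 0]) (use first in auto)
  have l: "summable (\<lambda>n. real n * (2 * real n - 1) * (norm (p n) + norm (q n)))"
    by (rule summable_comparison_test'[OF summable_mult[OF \<sigma>(1), of 2], of 0])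
      (use second nonneg in \<open>simp add: abs_of_nonneg\<close>)
  show ?thesis
  proof (rule UK_H_if_coefficient_sum[OF p_sums _ _ q_sums _ k _ l])
    show "p 0 = 0" "p 1 = 0" "q 0 = 0" by (simp_all add: p_def q_def)
    show "(\<Sum>n. real n * (norm (p n) + norm (q n))) < 1"
      using suminf_le[OF first k \<sigma>(1)] \<sigma>(2) by linarith
    show "(\<Sum>n. real n * (2 * real n - 1) * (norm (p n) + norm (q n))) \<le> 1"
      using suminf_le[OF second l summable_mult[OF \<sigma>(1)]] \<sigma>(2) by (simp add: suminf_mult[OF \<sigma>(1)])
  qed
qed

end
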